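(* Let $G$ be a (finite) distance-regular graph on $n$ vertices with adjacency matrix $W$, and let $\mathcal{S}=\mathcal{E}(W)$ be an orthonormal basis of $\mathbb{R}^n$ consisting of eigenvectors of $W$. Then $$z_{SP_{\mathcal{S}}}=z_{GW}=z_{SD_{\mathcal{S}}}.$$
   Context: For a graph $G$ and a vertex $u$, let $G_j(u)$ be the set of vertices at distance exactly $j$ from $u$ (length of a shortest path). $G$ is distance-regular if it is connected, $d$-regular for some $d$, and there exist integers $c_i,b_i$, $i\in\mathbb{N}$, such that for any two vertices $u,v$ at distance $i=d(u,v)$ there are precisely $c_i$ neighbours of $v$ in $G_{i+1}(u)$ and $b_i$ neighbours of $v$ in $G_{i-1}(u)$. $\mathbb{S}^n$ is the set of real symmetric $n\times n$ matrices, $\langle A,B\rangle=\mathrm{tr}(AB)$, $[n]=\{1,\dots,n\}$. For a finite set $\mathcal{S}=\{v_1,\dots,v_s\}\subseteq\mathbb{R}^n$ define the following optimal values: $$z_{GW}=\max\{\langle -W,X\rangle:\ X\in\mathbb{S}^n,\ X\succeq0,\ X_{ii}=1\ \forall i\in[n]\},$$ $$z_{SP_{\mathcal{S}}}=\max\{\langle -W,X\rangle:\ X\in\mathbb{S}^n,\ v^\top Xv\ge0\ \forall v\in\mathcal{S},\ X_{ii}=1\ \forall i\in[n],\ |X_{ij}|\le1\ \forall i,j\in[n]\},$$ $$z_{SD_{\mathcal{S}}}=\max\Big\{\Big\langle -W,\sum_{i=1}^s\eta_iv_iv_i^\top\Big\rangle:\ \eta\in\mathbb{R}^s,\ \eta_i\ge0\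 \forall i,\ \Big(\sum_{i=1}^s\eta_iv_iv_i^\top\Big)_{jj}\le1\ \forall j\in[n]\Big\}.$$ *)

theory Defs
  imports "HOL-Analysis.Analysis"
begin

section \<open>Distance-regular graphs\<close>

text \<open>A graph on \<open>n\<close> vertices is given by its adjacency relation on a finite index type
  \<open>'n\<close> with \<open>CARD('n) = n\<close>.\<close>

definition simple_graph :: "('n \<Rightarrow> 'n \<Rightarrow> bool) \<Rightarrow> bool" where
  "simple_graph E \<longleftrightarrow> symp E \<and> irreflp E"

definition is_path :: "('n \<Rightarrow> 'n \<Rightarrow> bool) \<Rightarrow> 'n \<Rightarrow> 'n list \<Rightarrow> 'n \<Rightarrow> bool" where
  "is_path E u p v \<longleftrightarrow>
     p \<noteq> [] \<and> hd p = u \<and> last p = v \<and> successively E p \<and> distinct p"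

definition connected_graph :: "('n \<Rightarrow> 'n \<Rightarrow> bool) \<Rightarrow> bool" where
  "connected_graph E \<longleftrightarrow> (\<forall>u v. \<exists>p. is_path E u p v)"

text \<open>Paths are lists of vertices, so the length of a path is one less than the length of the
  list. The value of \<open>graph_dist\<close> is meaningful only for vertices joined by a path.\<close>

definition graph_dist :: "('n \<Rightarrow> 'n \<Rightarrow> bool) \<Rightarrow> 'n \<Rightarrow> 'n \<Rightarrow> nat" where
  "graph_dist E u v = (LEAST k. \<exists>p. is_path E u p v \<and> length p = Suc k)"

definition neighbours :: "('n \<Rightarrow> 'n \<Rightarrow> bool) \<Rightarrow> 'n \<Rightarrow> 'n set" where
  "neighbours E v = {w. E v w}"

text \<open>The index is an integer so that the sphere of radius \<open>-1\<close> is empty.\<close>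

definition dist_sphere :: "('n \<Rightarrow> 'n \<Rightarrow> bool) \<Rightarrow> int \<Rightarrow> 'n \<Rightarrow> 'n set" where
  "dist_sphere E j u = {w. int (graph_dist E u w) = j}"

definition regular_graph :: "('n \<Rightarrow> 'n \<Rightarrow> bool) \<Rightarrow> nat \<Rightarrow> bool" where
  "regular_graph E d \<longleftrightarrow> (\<forall>v. card (neighbours E v) = d)"

text \<open>Here \<open>c\<close> counts the neighbours farther away and \<open>b\<close> those closer; much of
  the literature uses these two letters the other way round.\<close>

definition distance_regular :: "('n::finite \<Rightarrow> 'n \<Rightarrow> bool) \<Rightarrow> bool" where
  "distance_regular E \<longleftrightarrow>
     connected_graph E \<and> (\<exists>d. regular_graph E d) \<and>
     (\<exists>c b :: nat \<Rightarrow> int. \<forall>u v i. graph_dist E u v = i \<longrightarrow>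
        int (card (neighbours E v \<inter> dist_sphere E (int i + 1) u)) = c i \<and>
        int (card (neighbours E v \<inter> dist_sphere E (int i - 1) u)) = b i)"

definition adjacency_matrix :: "('n::finite \<Rightarrow> 'n \<Rightarrow> bool) \<Rightarrow> real^'n^'n" where
  "adjacency_matrix E = (\<chi> i j. if E i j then 1 else 0)"

section \<open>Orthonormal eigenbases\<close>

definition is_eigenvector :: "real^'n^'n \<Rightarrow> real^'n \<Rightarrow> bool" where
  "is_eigenvector A v \<longleftrightarrow> v \<noteq> 0 \<and> (\<exists>\<mu>. A *v v = \<mu> *\<^sub>R v)"

definition orthonormal_basis :: "(real^'n) set \<Rightarrow> bool" where
  "orthonormal_basis S \<longleftrightarrow>
     independent S \<and> span S = UNIV \<and> pairwise orthogonal S \<and> (\<forall>v\<in>S. norm v = 1)"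

definition orthonormal_eigenbasis :: "real^'n^'n \<Rightarrow> (real^'n) set \<Rightarrow> bool" where
  "orthonormal_eigenbasis A S \<longleftrightarrow> orthonormal_basis S \<and> (\<forall>v\<in>S. is_eigenvector A v)"

section \<open>The three optimisation problems\<close>

definition mat_inner :: "real^'n^'n \<Rightarrow> real^'n^'n \<Rightarrow> real" where
  "mat_inner A B = trace (A ** B)"

definition sym_mat :: "real^'n^'n \<Rightarrow> bool" where
  "sym_mat X \<longleftrightarrow> transpose X = X"

definition pos_semidef :: "real^'n^'n \<Rightarrow> bool" where
  "pos_semidef X \<longleftrightarrow> (\<forall>x. 0 \<le> x \<bullet> (X *v x))"

definition outer_square :: "real^'n \<Rightarrow> real^'n^'n" where
  "outer_square v = (\<chi> i j. v $ i * v $ j)"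

definition weighted_outer :: "(real^'n) set \<Rightarrow> (real^'n \<Rightarrow> real) \<Rightarrow> real^'n^'n" where
  "weighted_outer S \<eta> = (\<Sum>v\<in>S. \<eta> v *\<^sub>R outer_square v)"

definition GW_feasible :: "(real^'n^'n) set" where
  "GW_feasible = {X. sym_mat X \<and> pos_semidef X \<and> (\<forall>i. X $ i $ i = 1)}"

definition SP_feasible :: "(real^'n) set \<Rightarrow> (real^'n^'n) set" where
  "SP_feasible S = {X. sym_mat X \<and> (\<forall>v\<in>S. 0 \<le> v \<bullet> (X *v v)) \<and>
     (\<forall>i. X $ i $ i = 1) \<and> (\<forall>i j. \<bar>X $ i $ j\<bar> \<le> 1)}"

text \<open>The coefficients are indexed by the vectors of \<open>S\<close> themselves; the values of
  \<open>\<eta>\<close> outside \<open>S\<close> are irrelevant.\<close>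

definition SD_feasible :: "(real^'n) set \<Rightarrow> (real^'n \<Rightarrow> real) set" where
  "SD_feasible S = {\<eta>. (\<forall>v\<in>S. 0 \<le> \<eta> v) \<and> (\<forall>j. weighted_outer S \<eta> $ j $ j \<le> 1)}"

text \<open>The optimal values are defined as suprema; the lemmas \<open>z_GW_is_max\<close>,
  \<open>z_SP_is_max\<close> and \<open>z_SD_is_max\<close> below show that they are attained maxima.\<close>

definition z_GW :: "real^'n^'n \<Rightarrow> real" where
  "z_GW W = (SUP X\<in>GW_feasible. mat_inner (- W) X)"

definition z_SP :: "(real^'n) set \<Rightarrow> real^'n^'n \<Rightarrow> real" where
  "z_SP S W = (SUP X\<in>SP_feasible S. mat_inner (- W) X)"

definition z_SD :: "(real^'n) set \<Rightarrow> real^'n^'n \<Rightarrow> real" where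
  "z_SD S W = (SUP \<eta>\<in>SD_feasible S. mat_inner (- W) (weighted_outer S \<eta>))"

section \<open>The optimal values are attained\<close>

definition is_max_on :: "'a set \<Rightarrow> ('a \<Rightarrow> real) \<Rightarrow> real \<Rightarrow> bool" where
  "is_max_on F f z \<longleftrightarrow> (\<exists>x\<in>F. f x = z) \<and> (\<forall>x\<in>F. f x \<le> z)"

lemma is_max_on_SUP:
  assumes "x \<in> F" "\<And>y. y \<in> F \<Longrightarrow> f y \<le> f x"
  shows "is_max_on F f (SUP x\<in>F. f x)"
proof -
  have "(SUP x\<in>F. f x) = f x"
    using assms by (intro cSup_eq_maximum) auto
  then show ?thesis
    using assms by (auto simp: is_max_on_def)
qed

lemma is_max_on_compact:
  fixes F :: "'a::topological_space set"
  assumes "compact F" "F \<noteq> {}" "continuous_on F f"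
  shows "is_max_on F f (SUP x\<in>F. f x)"
proof -
  obtain x where "x \<in> F" "\<forall>y\<in>F. f y \<le> f x"
    using continuous_attains_sup[OF assms] by blast
  then show ?thesis
    by (intro is_max_on_SUP) auto
qed

lemma mat_inner_eq: "mat_inner A B = (\<Sum>i\<in>UNIV. \<Sum>k\<in>UNIV. A $ i $ k * B $ k $ i)"
  by (simp add: mat_inner_def trace_def matrix_matrix_mult_def)

lemma quadratic_form_eq:
  fixes X :: "real^'n^'n"
  shows "x \<bullet> (X *v x) = (\<Sum>i\<in>UNIV. x $ i * (\<Sum>j\<in>UNIV. X $ i $ j * x $ j))"
  by (simp add: inner_vec_def matrix_vector_mult_def)

lemma continuous_mat_inner: "continuous_on F (\<lambda>X. mat_inner A X)"
  unfolding mat_inner_eq by (intro continuous_intros)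

lemma closed_sym_mat: "closed {X :: real^'n^'n. sym_mat X}"
proof -
  have eq: "{X :: real^'n^'n. sym_mat X} = {X. \<forall>i j. X $ j $ i = X $ i $ j}"
    by (auto simp: sym_mat_def transpose_def vec_eq_iff)
  show ?thesis
    unfolding eq by (intro closed_Collect_all closed_Collect_eq continuous_intros)
qed

lemma bounded_entries:
  fixes F :: "(real^'n^'n) set"
  assumes "\<And>X i j. X \<in> F \<Longrightarrow> \<bar>X $ i $ j\<bar> \<le> 1"
  shows "bounded F"
proof (rule boundedI)
  fix X assume X: "X \<in> F"
  have row: "norm (X $ i) \<le> real CARD('n)" for i
  proof -
    have "norm (X $ i) \<le> (\<Sum>j\<in>UNIV. \<bar>X $ i $ j\<bar>)"
      by (rule norm_le_l1_cart)
    also have "\<dots> \<le> (\<Sum>j\<in>(UNIV::'n set). 1)"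
      by (intro sum_mono assms X)
    finally show ?thesis by simp
  qed
  have "norm X \<le> (\<Sum>i\<in>UNIV. norm (X $ i))"
    unfolding norm_vec_def by (rule L2_set_le_sum) simp
  also have "\<dots> \<le> (\<Sum>i\<in>(UNIV::'n set). real CARD('n))"
    by (intro sum_mono row)
  finally show "norm X \<le> real CARD('n) * real CARD('n)" by simp
qed

lemma GW_entry_bound:
  assumes "X \<in> GW_feasible"
  shows "\<bar>X $ i $ j\<bar> \<le> 1"
proof (cases "i = j")
  case True
  then show ?thesis using assms by (simp add: GW_feasible_def)
next
  case False
  have sym: "X $ j $ i = X $ i $ j"
    using assms by (auto simp: GW_feasible_def sym_mat_def transpose_def vec_eq_iff)
  have diag: "X $ i $ i = 1" "X $ j $ j = 1"
    using assms by (auto simp: GW_feasible_def)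
  have form: "0 \<le> 2 + 2 * s * X $ i $ j" if s: "s * s = 1" for s
  proof -
    let ?x = "axis i 1 + s *\<^sub>R axis j 1"
    have "0 \<le> ?x \<bullet> (X *v ?x)"
      using assms by (simp add: GW_feasible_def pos_semidef_def)
    also have "\<dots> = X $ i $ i + s * X $ i $ j + s * X $ j $ i + (s * s) * X $ j $ j"
      by (simp add: matrix_vector_right_distrib scaleR_matrix_vector_assoc[symmetric]
          matrix_vector_mult_scaleR matrix_vector_mult_basis column_def
          inner_add_left inner_add_right inner_axis' algebra_simps)
    finally show ?thesis
      using sym diag s by simp
  qed
  show ?thesis
    using form[of 1] form[of "-1"] by simp
qed

lemma mat_1_in_GW_feasible: "mat 1 \<in> GW_feasible"
  by (simp add: GW_feasible_def sym_mat_def pos_semidef_def) (simp add: mat_def)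

lemma GW_subset_SP: "GW_feasible \<subseteq> SP_feasible S"
  using GW_entry_bound by (auto simp: GW_feasible_def SP_feasible_def pos_semidef_def)

lemma compact_GW_feasible: "compact (GW_feasible :: (real^'n^'n) set)"
proof -
  have "closed {X :: real^'n^'n. pos_semidef X}" "closed {X :: real^'n^'n. \<forall>i. X $ i $ i = 1}"
    unfolding pos_semidef_def quadratic_form_eq
    by (intro closed_Collect_all closed_Collect_le closed_Collect_eq continuous_intros)+
  then have "closed ({X. sym_mat X} \<inter> {X. pos_semidef X} \<inter> {X :: real^'n^'n. \<forall>i. X $ i $ i = 1})"
    by (intro closed_Int closed_sym_mat)
  also have "\<dots> = GW_feasible"
    by (auto simp: GW_feasible_def)
  finally show ?thesis
    using bounded_entries[OF GW_entry_bound] by (simp add: compact_eq_bounded_closed)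
qed

lemma compact_SP_feasible:
  fixes S :: "(real^'n) set"
  shows "compact (SP_feasible S)"
proof -
  have "closed {X :: real^'n^'n. \<forall>v\<in>S. 0 \<le> v \<bullet> (X *v v)}"
    "closed {X :: real^'n^'n. \<forall>i. X $ i $ i = 1}"
    "closed {X :: real^'n^'n. \<forall>i j. \<bar>X $ i $ j\<bar> \<le> 1}"
    unfolding Ball_def quadratic_form_eq
    by (intro closed_Collect_all closed_Collect_imp closed_Collect_le closed_Collect_eq
        continuous_intros open_Collect_const)+
  then have "closed ({X. sym_mat X} \<inter> {X. \<forall>v\<in>S. 0 \<le> v \<bullet> (X *v v)} \<inter>
      {X. \<forall>i. X $ i $ i = 1} \<inter> {X :: real^'n^'n. \<forall>i j. \<bar>X $ i $ j\<bar> \<le> 1})"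
    by (intro closed_Int closed_sym_mat)
  also have "\<dots> = SP_feasible S"
    by (auto simp: SP_feasible_def)
  finally show ?thesis
    using bounded_entries[of "SP_feasible S"]
    by (simp add: compact_eq_bounded_closed SP_feasible_def)
qed

lemma z_GW_is_max: "is_max_on GW_feasible (mat_inner (- W)) (z_GW W)"
  unfolding z_GW_def using mat_1_in_GW_feasible
  by (intro is_max_on_compact compact_GW_feasible continuous_mat_inner) auto

lemma z_SP_is_max: "is_max_on (SP_feasible S) (mat_inner (- W)) (z_SP S W)"
  unfolding z_SP_def using mat_1_in_GW_feasible GW_subset_SP
  by (intro is_max_on_compact compact_SP_feasible continuous_mat_inner) auto

lemma weighted_outer_entry: "weighted_outer S \<eta> $ i $ j = (\<Sum>v\<in>S. \<eta> v * (v $ i * v $ j))"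
  by (simp add: weighted_outer_def outer_square_def)

text \<open>An unbounded coefficient is possible only for the zero vector, where it has no effect; hence
  the maximum may be taken over a compact box.\<close>

lemma z_SD_is_max:
  fixes S :: "(real^'n) set"
  assumes "finite S"
  shows "is_max_on (SD_feasible S) (\<lambda>\<eta>. mat_inner (- W) (weighted_outer S \<eta>)) (z_SD S W)"
proof -
  define f where "f = (\<lambda>\<eta>. mat_inner (- W) (weighted_outer S \<eta>))"
  define B :: "real^'n \<Rightarrow> real"
    where "B v = (if v \<in> S then \<Sum>j\<in>UNIV. if v $ j = 0 then 0 else 1 / (v $ j * v $ j) else 0)" for v
  define D where "D = PiE UNIV (\<lambda>v. {0..B v}) \<inter> {\<eta>. \<forall>j. weighted_outer S \<eta> $ j $ j \<le> 1}"
  have B0: "0 \<le> B v" for v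
    unfolding B_def by (auto intro!: sum_nonneg)
  have "compactin (product_topology (\<lambda>v. euclidean) UNIV) (PiE UNIV (\<lambda>v. {0..B v}))"
    by (subst compactin_PiE) auto
  then have "compact (PiE UNIV (\<lambda>v. {0..B v}))"
    by (simp add: euclidean_product_topology)
  moreover have "closed {\<eta>. \<forall>j. weighted_outer S \<eta> $ j $ j \<le> 1}"
    unfolding weighted_outer_entry
    by (intro closed_Collect_all closed_Collect_le continuous_intros
        continuous_on_product_coordinates)
  ultimately have "compact D"
    unfolding D_def by (rule compact_Int_closed)
  moreover have "(\<lambda>_. 0) \<in> D"
    using B0 by (simp add: D_def weighted_outer_entry PiE_def Pi_def)
  moreover have "continuous_on D f"
    unfolding f_def mat_inner_eq weighted_outer_entry
    by (intro continuous_intros continuous_on_subset[OF continuous_on_product_coordinates]) auto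
  ultimately obtain \<eta> where \<eta>: "\<eta> \<in> D" "\<And>\<theta>. \<theta> \<in> D \<Longrightarrow> f \<theta> \<le> f \<eta>"
    using continuous_attains_sup[of D f] by blast
  have "\<eta> \<in> SD_feasible S"
    using \<eta>(1) by (auto simp: D_def SD_feasible_def PiE_def Pi_def)
  moreover have "f \<theta> \<le> f \<eta>" if \<theta>: "\<theta> \<in> SD_feasible S" for \<theta>
  proof -
    define \<theta>' where "\<theta>' v = (if v \<in> S \<and> v \<noteq> 0 then \<theta> v else 0)" for v
    have same: "weighted_outer S \<theta>' = weighted_outer S \<theta>"
      unfolding vec_eq_iff weighted_outer_entry by (auto simp: \<theta>'_def intro!: sum.cong)
    have "\<theta> v \<le> B v" if v: "v \<in> S" "v \<noteq> 0" for v
    proof -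
      obtain j where j: "v $ j \<noteq> 0"
        using v(2) by (auto simp: vec_eq_iff)
      have "\<theta> v * (v $ j * v $ j) \<le> (\<Sum>v\<in>S. \<theta> v * (v $ j * v $ j))"
        using \<theta> by (intro member_le_sum v assms) (auto simp: SD_feasible_def)
      also have "\<dots> \<le> 1"
        using \<theta> by (simp add: SD_feasible_def weighted_outer_entry)
      finally have "\<theta> v \<le> (if v $ j = 0 then 0 else 1 / (v $ j * v $ j))"
        using j pos_le_divide_eq[of "v $ j * v $ j" "\<theta> v" 1]
        by (auto simp: zero_less_mult_iff linorder_neq_iff)
      also have "\<dots> \<le> (\<Sum>j\<in>UNIV. if v $ j = 0 then 0 else 1 / (v $ j * v $ j))"
        by (intro member_le_sum[where f = "\<lambda>j. if v $ j = 0 then 0 else 1 / (v $ j * v $ j)"]) auto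
      finally show ?thesis
        using v by (simp add: B_def)
    qed
    then have "\<theta>' \<in> D"
      using \<theta> B0 same by (auto simp: D_def SD_feasible_def \<theta>'_def)
    then show ?thesis
      using \<eta>(2)[of \<theta>'] same by (simp add: f_def)
  qed
  ultimately show ?thesis
    unfolding z_SD_def f_def[symmetric] by (intro is_max_on_SUP[of \<eta>]) auto
qed

lemma orthonormal_basis_finite: "orthonormal_basis S \<Longrightarrow> finite S"
  using independent_imp_finite by (auto simp: orthonormal_basis_def)

end

theory Submission
  imports Defs
begin

text \<open>
  Let \<open>\<theta>\<close> be the least eigenvalue of \<open>W\<close>; since \<open>W\<close> has trace zero, \<open>\<theta> \<le> 0\<close>. All
  three optimal values equal \<open>- \<theta> n\<close>.

  Upper bounds: expanding in the eigenbasis gives \<open>\<langle>W, X\<rangle> = \<Sum>\<^sub>v \<lambda>\<^sub>v (v \<bullet> X v)\<close> for every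
  matrix \<open>X\<close>, where \<open>\<lambda>\<^sub>v\<close> is the eigenvalue of the basis vector \<open>v\<close>. So as soon as
  \<open>v \<bullet> X v \<ge> 0\<close> for all \<open>v\<close> in the basis, \<open>\<langle>-W, X\<rangle> \<le> - \<theta> tr X\<close>. This applies to the
  feasible matrices of all three problems, and their trace is equal to \<open>n\<close> or, in the third
  problem, at most \<open>n\<close>.

  Attainment: equality needs \<open>v \<bullet> X v = 0\<close> unless \<open>\<lambda>\<^sub>v = \<theta>\<close>. The natural candidate is
  the orthogonal projector onto the eigenspace of \<open>\<theta>\<close>, scaled so that its diagonal is \<open>1\<close>; it is
  feasible for all three problems at once (lemma \<open>optimal_values_eq\<close>). The scaling is
  possible only if the diagonal of the projector is constant, and this is where
  distance-regularity enters. Up to a positive factor the projector is \<open>g(W)\<close> for the polynomial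
  \<open>g(x) = \<Prod>\<^sub>t (t - x)\<close>, with \<open>t\<close> ranging over the other eigenvalues. The matrices whose
  \<open>(u, w)\<close> entry depends only on the distance of \<open>u\<close> and \<open>w\<close> contain the identity and are closed
  under linear combinations and under multiplication by \<open>W\<close>
  (lemma \<open>dist_determined_neighbour_sum\<close>), so they contain \<open>g(W)\<close>
  (lemma \<open>dist_determined_spectral_prod\<close>); its diagonal entries all belong to distance \<open>0\<close>.
\<close>

section \<open>Distances in a distance-regular graph\<close>

text \<open>Paths do not repeat vertices, so a path ending in \<open>w\<close> cannot always be prolonged to a neighbour
  \<open>x\<close> of \<open>w\<close>; if it already meets \<open>x\<close>, it is cut off there.\<close>
lemma is_path_extend:
  assumes "is_path E u p w" "E w x"
  shows "\<exists>q. is_path E u q x \<and> length q \<le> Suc (length p)"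
proof (cases "x \<in> set p")
  case True
  then obtain ys zs where p: "p = ys @ x # zs"
    by (meson split_list)
  have "is_path E u (ys @ [x]) x"
    using assms(1) unfolding is_path_def p
    by (cases ys) (auto simp: successively_append_iff successively_Cons hd_append)
  then show ?thesis
    using p by (intro exI[of _ "ys @ [x]"]) auto
next
  case False
  then have "is_path E u (p @ [x]) x"
    using assms by (auto simp: is_path_def successively_append_iff)
  then show ?thesis
    by (intro exI[of _ "p @ [x]"]) auto
qed

lemma graph_dist_le:
  assumes "is_path E u p v"
  shows "graph_dist E u v \<le> length p - 1"
proof -
  have "length p = Suc (length p - 1)"
    using assms by (cases p) (auto simp: is_path_def)
  then show ?thesis
    unfolding graph_dist_def using assms by (intro Least_le) blast
qed

lemma graph_dist_attained:
  assumes "connected_graph E"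
  obtains p where "is_path E u p v" "length p = Suc (graph_dist E u v)"
proof -
  obtain p where p: "is_path E u p v"
    using assms by (auto simp: connected_graph_def)
  then have "length p = Suc (length p - 1)"
    by (cases p) (auto simp: is_path_def)
  then have "\<exists>k p. is_path E u p v \<and> length p = Suc k"
    using p by blast
  then have "\<exists>p. is_path E u p v \<and> length p = Suc (graph_dist E u v)"
    unfolding graph_dist_def by (rule LeastI_ex)
  then show thesis
    using that by blast
qed

lemma graph_dist_eq_0_iff:
  assumes "connected_graph E"
  shows "graph_dist E u v = 0 \<longleftrightarrow> u = v"
proof
  assume 0: "graph_dist E u v = 0"
  obtain p where "is_path E u p v" "length p = Suc (graph_dist E u v)"
    using graph_dist_attained[OF assms] .
  then show "u = v"
    using 0 by (auto simp: is_path_def length_Suc_conv)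
next
  assume "u = v"
  then have "is_path E u [u] v"
    by (simp add: is_path_def)
  then show "graph_dist E u v = 0"
    using graph_dist_le by fastforce
qed

lemma graph_dist_neighbour_le:
  assumes "connected_graph E" "E w x"
  shows "graph_dist E u x \<le> Suc (graph_dist E u w)"
proof -
  obtain p where p: "is_path E u p w" "length p = Suc (graph_dist E u w)"
    using graph_dist_attained[OF assms(1)] .
  obtain q where "is_path E u q x" "length q \<le> Suc (length p)"
    using is_path_extend[OF p(1) assms(2)] by blast
  then show ?thesis
    using graph_dist_le[of E u q x] p(2) by simp
qed

definition dist_determined :: "('n \<Rightarrow> 'n \<Rightarrow> bool) \<Rightarrow> ('n \<Rightarrow> 'n \<Rightarrow> real) \<Rightarrow> bool" where
  "dist_determined E K \<longleftrightarrow> (\<exists>f. \<forall>u w. K u w = f (graph_dist E u w))"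

text \<open>This is the step that uses distance-regularity: multiplication by the adjacency matrix
  preserves dependence on the distance. A neighbour of \<open>w\<close> is at distance \<open>i - 1\<close>, \<open>i\<close> or
  \<open>i + 1\<close> from \<open>u\<close>, where \<open>i\<close> is the distance of \<open>u\<close> and \<open>w\<close>, and the number of neighbours of
  each of these kinds depends on \<open>i\<close> only.\<close>
lemma dist_determined_neighbour_sum:
  fixes E :: "'n::finite \<Rightarrow> 'n \<Rightarrow> bool"
  assumes graph: "simple_graph E" "distance_regular E"
    and K: "dist_determined E K"
  shows "dist_determined E (\<lambda>u w. \<Sum>x\<in>neighbours E w. K u x)"
proof -
  obtain f where f: "\<And>u w. K u w = f (graph_dist E u w)"
    using K by (auto simp: dist_determined_def)
  have conn: "connected_graph E"
    using graph by (simp add: distance_regular_def)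
  obtain d where d: "\<And>w. card (neighbours E w) = d"
    using graph by (auto simp: distance_regular_def regular_graph_def)
  from graph(2) obtain c b :: "nat \<Rightarrow> int" where cb:
    "\<And>u w. int (card (neighbours E w \<inter> dist_sphere E (int (graph_dist E u w) + 1) u))
        = c (graph_dist E u w)"
    "\<And>u w. int (card (neighbours E w \<inter> dist_sphere E (int (graph_dist E u w) - 1) u))
        = b (graph_dist E u w)"
    unfolding distance_regular_def by blast
  \<comment> \<open>Each of the \<open>d\<close> neighbours is counted with \<open>f i\<close>, and those on the two other spheres are
      corrected. For \<open>i = 0\<close> the truncated \<open>i - 1\<close> is harmless: its term has the factor \<open>b 0 = 0\<close>
      and a vanishing difference.\<close>
  define h where "h i = real d * f i + real_of_int (c i) * (f (i + 1) - f i)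
      + real_of_int (b i) * (f (i - 1) - f i)" for i
  have "(\<Sum>x\<in>neighbours E w. K u x) = h (graph_dist E u w)" for u w
  proof -
    define i where "i = graph_dist E u w"
    let ?N = "neighbours E w"
    let ?F = "dist_sphere E (int i + 1) u" and ?C = "dist_sphere E (int i - 1) u"
    have split: "K u x = f i + (if x \<in> ?F then f (i + 1) - f i else 0)
        + (if x \<in> ?C then f (i - 1) - f i else 0)" if x: "x \<in> ?N" for x
    proof -
      have "E w x" "E x w"
        using x graph(1) by (auto simp: neighbours_def simple_graph_def symp_def)
      then have "graph_dist E u x \<le> Suc i" "i \<le> Suc (graph_dist E u x)"
        unfolding i_def by (auto intro: graph_dist_neighbour_le[OF conn])
      then consider "graph_dist E u x = i + 1" | "graph_dist E u x = i"
        | "i = graph_dist E u x + 1"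
        by linarith
      then show ?thesis
        by cases (auto simp: dist_sphere_def f)
    qed
    have "(\<Sum>x\<in>?N. K u x) = (\<Sum>x\<in>?N. f i + (if x \<in> ?F then f (i + 1) - f i else 0)
        + (if x \<in> ?C then f (i - 1) - f i else 0))"
      using split by (rule sum.cong[OF refl])
    also have "\<dots> = real (card ?N) * f i + real (card (?N \<inter> ?F)) * (f (i + 1) - f i)
        + real (card (?N \<inter> ?C)) * (f (i - 1) - f i)"
      by (simp add: sum.distrib flip: sum.inter_restrict)
    also have "\<dots> = h i"
      using arg_cong[OF cb(1)[of w u], of real_of_int] arg_cong[OF cb(2)[of w u], of real_of_int]
      by (simp add: h_def i_def d)
    finally show ?thesis
      by (simp add: i_def)
  qed
  then show ?thesis
    unfolding dist_determined_def by blast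
qed

section \<open>Spectral calculus in an orthonormal eigenbasis\<close>

text \<open>On a unit eigenvector this is the eigenvalue; for an arbitrary matrix it is the quadratic form
  that is constrained in the second optimisation problem.\<close>
definition rayleigh :: "real^'n^'n \<Rightarrow> real^'n \<Rightarrow> real" where
  "rayleigh A v = v \<bullet> (A *v v)"

lemma eigenbasis_mult:
  assumes "orthonormal_eigenbasis A S" "v \<in> S"
  shows "A *v v = rayleigh A v *\<^sub>R v"
proof -
  obtain \<mu> where \<mu>: "A *v v = \<mu> *\<^sub>R v"
    using assms by (auto simp: orthonormal_eigenbasis_def is_eigenvector_def)
  have "v \<bullet> v = 1"
    using assms by (simp add: orthonormal_eigenbasis_def orthonormal_basis_def dot_square_norm)
  then show ?thesis
    by (simp add: rayleigh_def \<mu>)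
qed

lemma orthonormal_basis_completeness:
  fixes S :: "(real^'n) set"
  assumes "orthonormal_basis S"
  shows "(\<Sum>v\<in>S. v $ u * v $ w) = (if u = w then 1 else 0)"
proof -
  have "(\<Sum>v\<in>S. (axis u 1 \<bullet> v) *\<^sub>R v) = axis u 1"
    using assms by (intro orthonormal_basis_expand orthonormal_basis_finite)
      (auto simp: orthonormal_basis_def)
  then have "(\<Sum>v\<in>S. (axis u 1 \<bullet> v) *\<^sub>R v) $ w = axis u 1 $ w"
    by simp
  moreover have "axis u 1 $ w = (if u = w then 1 else 0 :: real)"
    by (simp add: axis_def)
  ultimately show ?thesis
    by (simp add: inner_axis')
qed

text \<open>The \<open>(u, w)\<close> entry of \<open>g(A)\<close> in the functional calculus of a matrix \<open>A\<close> with orthonormal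
  eigenbasis \<open>S\<close>.\<close>
definition spectral_fun :: "(real^'n) set \<Rightarrow> real^'n^'n \<Rightarrow> (real \<Rightarrow> real) \<Rightarrow> 'n \<Rightarrow> 'n \<Rightarrow> real" where
  "spectral_fun S A g u w = (\<Sum>v\<in>S. g (rayleigh A v) * (v $ u * v $ w))"

text \<open>In terms of matrices, \<open>((t - x) g)(A) = t g(A) - A g(A)\<close>, where
  \<open>A v = \<lambda> v\<close> is read off in the coordinate \<open>w\<close>.\<close>
lemma spectral_fun_mult_factor:
  fixes A :: "real^'n^'n"
  assumes "orthonormal_eigenbasis A S"
  shows "spectral_fun S A (\<lambda>x. (t - x) * g x) u w
    = t * spectral_fun S A g u w - (\<Sum>x\<in>UNIV. A $ w $ x * spectral_fun S A g u x)"
proof -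
  have row: "rayleigh A v * v $ w = (\<Sum>x\<in>UNIV. A $ w $ x * v $ x)" if "v \<in> S" for v
    using arg_cong[OF eigenbasis_mult[OF assms that], of "\<lambda>y. y $ w"]
    by (simp add: matrix_vector_mult_def)
  have "(\<Sum>x\<in>UNIV. A $ w $ x * spectral_fun S A g u x)
      = (\<Sum>v\<in>S. g (rayleigh A v) * v $ u * (\<Sum>x\<in>UNIV. A $ w $ x * v $ x))"
    unfolding spectral_fun_def sum_distrib_left
    by (subst sum.swap) (simp add: mult_ac)
  also have "\<dots> = (\<Sum>v\<in>S. g (rayleigh A v) * v $ u * (rayleigh A v * v $ w))"
    by (simp add: row)
  finally show ?thesis
    by (simp add: spectral_fun_def sum_distrib_left algebra_simps sum_subtractf)
qed

text \<open>The spectral decomposition \<open>A = \<Sum>\<^sub>v \<lambda>\<^sub>v v v\<^sup>T\<close> turns the objective into a weighted sum of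
  the quantities \<open>v \<bullet> X v\<close>.\<close>
lemma mat_inner_eigenbasis:
  fixes A X :: "real^'n^'n"
  assumes "orthonormal_eigenbasis A S"
  shows "mat_inner A X = (\<Sum>v\<in>S. rayleigh A v * rayleigh X v)"
proof -
  have basis: "orthonormal_basis S"
    using assms by (simp add: orthonormal_eigenbasis_def)
  have entry: "A $ i $ k = (\<Sum>v\<in>S. rayleigh A v * (v $ i * v $ k))" for i k
  proof -
    have "(\<Sum>v\<in>S. rayleigh A v * (v $ i * v $ k)) = (\<Sum>v\<in>S. (A *v v) $ i * v $ k)"
      by (intro sum.cong) (simp_all add: eigenbasis_mult[OF assms])
    also have "\<dots> = (\<Sum>v\<in>S. \<Sum>j\<in>UNIV. A $ i $ j * (v $ j * v $ k))"
      by (simp add: matrix_vector_mult_def sum_distrib_right mult.assoc)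
    also have "\<dots> = (\<Sum>j\<in>UNIV. A $ i $ j * (\<Sum>v\<in>S. v $ j * v $ k))"
      by (subst sum.swap) (simp add: sum_distrib_left)
    also have "\<dots> = A $ i $ k"
      by (simp add: orthonormal_basis_completeness[OF basis] if_distrib cong: if_cong)
    finally show ?thesis ..
  qed
  have "mat_inner A X = (\<Sum>i\<in>UNIV. \<Sum>k\<in>UNIV. \<Sum>v\<in>S. rayleigh A v * (v $ k * (X $ k $ i * v $ i)))"
    by (simp add: mat_inner_eq entry sum_distrib_left sum_distrib_right mult_ac)
  also have "\<dots> = (\<Sum>v\<in>S. \<Sum>k\<in>UNIV. \<Sum>i\<in>UNIV. rayleigh A v * (v $ k * (X $ k $ i * v $ i)))"
    by (subst sum.swap, subst sum.swap[of _ S], subst sum.swap) (rule refl)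
  finally show ?thesis
    by (simp add: rayleigh_def[of X] quadratic_form_eq sum_distrib_left)
qed

text \<open>Every orthonormal basis is an eigenbasis of the identity matrix, so this is the case \<open>A = 1\<close> of
  the preceding expansion.\<close>
lemma trace_eigenbasis:
  fixes X :: "real^'n^'n"
  assumes "orthonormal_basis S"
  shows "trace X = (\<Sum>v\<in>S. rayleigh X v)"
proof -
  have eb: "orthonormal_eigenbasis (mat 1 :: real^'n^'n) S"
    using assms unfolding orthonormal_eigenbasis_def is_eigenvector_def orthonormal_basis_def
    by (force intro: exI[of _ 1])
  have "rayleigh (mat 1 :: real^'n^'n) v = 1" if "v \<in> S" for v
    using assms that by (simp add: rayleigh_def orthonormal_basis_def dot_square_norm)
  then show ?thesis
    using mat_inner_eigenbasis[OF eb, of X] by (simp add: mat_inner_def)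
qed

section \<open>The three optimal values and the least eigenvalue\<close>
lemma mat_inner_uminus_left: "mat_inner (- A) X = - mat_inner A X"
  by (simp add: mat_inner_eq sum_negf)

lemma rayleigh_weighted_outer:
  "rayleigh (weighted_outer S \<eta>) x = (\<Sum>v\<in>S. \<eta> v * (v \<bullet> x)\<^sup>2)"
proof -
  have "rayleigh (weighted_outer S \<eta>) x
      = (\<Sum>i\<in>UNIV. \<Sum>j\<in>UNIV. \<Sum>v\<in>S. \<eta> v * ((v $ i * x $ i) * (v $ j * x $ j)))"
    by (simp add: rayleigh_def quadratic_form_eq weighted_outer_entry sum_distrib_left
        sum_distrib_right mult_ac)
  also have "\<dots> = (\<Sum>v\<in>S. \<Sum>i\<in>UNIV. \<Sum>j\<in>UNIV. \<eta> v * ((v $ i * x $ i) * (v $ j * x $ j)))"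
    by (subst (2) sum.swap, subst sum.swap) (rule refl)
  finally show ?thesis
    by (simp only: inner_vec_def inner_real_def power2_eq_square sum_product)
      (simp only: sum_distrib_left)
qed

lemma rayleigh_weighted_outer_basis:
  assumes "orthonormal_basis S" "u \<in> S"
  shows "rayleigh (weighted_outer S \<eta>) u = \<eta> u"
proof -
  have "\<eta> v * (v \<bullet> u)\<^sup>2 = (if v = u then \<eta> u else 0)" if "v \<in> S" for v
    using assms that
    by (auto simp: orthonormal_basis_def dot_square_norm pairwise_def orthogonal_def)
  then show ?thesis
    using assms(2) orthonormal_basis_finite[OF assms(1)] by (simp add: rayleigh_weighted_outer)
qed

text \<open>The common upper bound. The objective sees \<open>X\<close> only through its quadratic form on the basis
  vectors, which is why testing finitely many vectors is as strong as semidefiniteness here.\<close>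
lemma mat_inner_uminus_le:
  fixes A X :: "real^'n^'n"
  assumes "orthonormal_eigenbasis A S"
    and "\<And>v. v \<in> S \<Longrightarrow> \<theta> \<le> rayleigh A v" "\<And>v. v \<in> S \<Longrightarrow> 0 \<le> rayleigh X v"
  shows "mat_inner (- A) X \<le> - \<theta> * trace X"
proof -
  have "\<theta> * trace X = (\<Sum>v\<in>S. \<theta> * rayleigh X v)"
    using trace_eigenbasis[of S X] assms(1)
    by (simp add: orthonormal_eigenbasis_def sum_distrib_left)
  also have "\<dots> \<le> (\<Sum>v\<in>S. rayleigh A v * rayleigh X v)"
    using assms by (intro sum_mono mult_right_mono) auto
  finally show ?thesis
    by (simp add: mat_inner_uminus_left mat_inner_eigenbasis[OF assms(1)])
qed

text \<open>A matrix with unit diagonal that is a nonnegative combination of squares of eigenvectors of the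
  least eigenvalue \<open>\<theta>\<close> is feasible for all three problems and attains the common upper bound. The
  condition \<open>\<theta> \<le> 0\<close> serves the third problem, whose feasible matrices may have trace less than
  the dimension.\<close>
lemma optimal_values_eq:
  fixes A :: "real^'n^'n" and S :: "(real^'n) set"
  assumes eb: "orthonormal_eigenbasis A S"
    and least: "\<And>v. v \<in> S \<Longrightarrow> \<theta> \<le> rayleigh A v"
    and nonpos: "\<theta> \<le> 0"
    and nonneg: "\<And>v. v \<in> S \<Longrightarrow> 0 \<le> \<eta> v"
    and supp: "\<And>v. v \<in> S \<Longrightarrow> \<eta> v \<noteq> 0 \<Longrightarrow> rayleigh A v = \<theta>"
    and diag: "\<And>i. weighted_outer S \<eta> $ i $ i = 1"
  shows "z_SP S A = - \<theta> * real CARD('n)"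
    and "z_GW A = - \<theta> * real CARD('n)"
    and "z_SD S A = - \<theta> * real CARD('n)"
proof -
  have basis: "orthonormal_basis S"
    using eb by (simp add: orthonormal_eigenbasis_def)
  let ?X = "weighted_outer S \<eta>"
  have trace: "trace X = real CARD('n)" if "\<And>i. X $ i $ i = 1" for X :: "real^'n^'n"
    using that by (simp add: trace_def)
  have "mat_inner A ?X = (\<Sum>v\<in>S. \<theta> * rayleigh ?X v)"
    unfolding mat_inner_eigenbasis[OF eb] using supp
    by (intro sum.cong) (auto simp: rayleigh_weighted_outer_basis[OF basis])
  also have "\<dots> = \<theta> * real CARD('n)"
    using trace[OF diag] trace_eigenbasis[OF basis, of ?X] by (simp flip: sum_distrib_left)
  finally have val: "mat_inner (- A) ?X = - \<theta> * real CARD('n)"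
    by (simp add: mat_inner_uminus_left)
  have "pos_semidef ?X"
    using nonneg unfolding pos_semidef_def rayleigh_def[symmetric] rayleigh_weighted_outer
    by (auto intro!: sum_nonneg)
  moreover have "sym_mat ?X"
    by (simp add: sym_mat_def transpose_def vec_eq_iff weighted_outer_entry mult_ac)
  ultimately have GW: "?X \<in> GW_feasible"
    using diag by (simp add: GW_feasible_def)
  have SP_le: "mat_inner (- A) X \<le> - \<theta> * real CARD('n)" if "X \<in> SP_feasible S" for X
    using mat_inner_uminus_le[OF eb least, of X] that trace[of X]
    by (simp add: SP_feasible_def rayleigh_def)
  show "z_SP S A = - \<theta> * real CARD('n)"
    unfolding z_SP_def using GW GW_subset_SP SP_le val
    by (intro cSup_eq_maximum) (auto intro!: image_eqI[of _ _ ?X])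
  show "z_GW A = - \<theta> * real CARD('n)"
    unfolding z_GW_def using GW GW_subset_SP SP_le val
    by (intro cSup_eq_maximum) (auto intro!: image_eqI[of _ _ ?X])
  have "mat_inner (- A) (weighted_outer S \<zeta>) \<le> - \<theta> * real CARD('n)"
    if \<zeta>: "\<zeta> \<in> SD_feasible S" for \<zeta>
  proof -
    have "trace (weighted_outer S \<zeta>) \<le> (\<Sum>i\<in>(UNIV::'n set). 1)"
      unfolding trace_def using \<zeta> by (intro sum_mono) (simp add: SD_feasible_def)
    then have "- \<theta> * trace (weighted_outer S \<zeta>) \<le> - \<theta> * real CARD('n)"
      using nonpos by (intro mult_left_mono) auto
    moreover have "mat_inner (- A) (weighted_outer S \<zeta>) \<le> - \<theta> * trace (weighted_outer S \<zeta>)"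
      using \<zeta> by (intro mat_inner_uminus_le[OF eb least])
        (auto simp: rayleigh_weighted_outer_basis[OF basis] SD_feasible_def)
    ultimately show ?thesis by linarith
  qed
  moreover have "\<eta> \<in> SD_feasible S"
    using nonneg diag by (simp add: SD_feasible_def)
  ultimately show "z_SD S A = - \<theta> * real CARD('n)"
    unfolding z_SD_def using val
    by (intro cSup_eq_maximum) (auto intro!: image_eqI[of _ _ \<eta>])
qed

section \<open>Polynomials in the adjacency matrix\<close>

text \<open>Starting from the identity matrix, the factors \<open>t - W\<close> are multiplied in one at a time. For the
  identity matrix the claim is the completeness relation of the basis together with the fact that
  only \<open>u = w\<close> gives distance \<open>0\<close>.\<close>
lemma dist_determined_spectral_prod:
  fixes E :: "'n::finite \<Rightarrow> 'n \<Rightarrow> bool"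
  assumes graph: "simple_graph E" "distance_regular E"
    and eb: "orthonormal_eigenbasis (adjacency_matrix E) S"
    and "finite T"
  shows "dist_determined E (spectral_fun S (adjacency_matrix E) (\<lambda>x. \<Prod>t\<in>T. t - x))"
  using \<open>finite T\<close>
proof (induction T rule: finite_induct)
  case empty
  have "spectral_fun S (adjacency_matrix E) (\<lambda>x. \<Prod>t\<in>{}. t - x) u w
      = (if graph_dist E u w = 0 then 1 else 0)" for u w
    using eb graph
    by (simp add: spectral_fun_def orthonormal_basis_completeness orthonormal_eigenbasis_def
        graph_dist_eq_0_iff distance_regular_def)
  then show ?case
    unfolding dist_determined_def by (intro exI[of _ "\<lambda>i. if i = 0 then 1 else 0"]) blast
next
  case (insert t T)
  let ?K = "spectral_fun S (adjacency_matrix E) (\<lambda>x. \<Prod>t\<in>T. t - x)"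
  obtain f where f: "\<And>u w. ?K u w = f (graph_dist E u w)"
    using insert.IH by (auto simp: dist_determined_def)
  obtain h where h: "\<And>u w. (\<Sum>x\<in>neighbours E w. ?K u x) = h (graph_dist E u w)"
    using dist_determined_neighbour_sum[OF graph insert.IH] by (auto simp: dist_determined_def)
  have nb: "(\<Sum>x\<in>UNIV. adjacency_matrix E $ w $ x * F x) = (\<Sum>x\<in>neighbours E w. F x)"
    for w :: 'n and F :: "'n \<Rightarrow> real"
    by (simp add: adjacency_matrix_def neighbours_def if_distrib[of "\<lambda>a. a * _"]
        sum.If_cases cong: if_cong)
  have "spectral_fun S (adjacency_matrix E) (\<lambda>x. \<Prod>t\<in>insert t T. t - x) u w
      = t * f (graph_dist E u w) - h (graph_dist E u w)" for u w
    using insert.hyps by (simp add: spectral_fun_mult_factor[OF eb] nb h) (simp add: f)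
  then show ?case
    unfolding dist_determined_def by (intro exI[of _ "\<lambda>i. t * f i - h i"]) blast
qed

theorem corollary4:
  fixes E :: "'n::finite \<Rightarrow> 'n \<Rightarrow> bool"
    and W :: "real^'n^'n"
    and S :: "(real^'n) set"
  assumes "simple_graph E"
    and "distance_regular E"
    and "W = adjacency_matrix E"
    and "orthonormal_eigenbasis W S"
  shows "z_SP S W = z_GW W \<and> z_GW W = z_SD S W"
proof -
  have basis: "orthonormal_basis S"
    using assms(4) by (simp add: orthonormal_eigenbasis_def)
  have fin: "finite S"
    by (rule orthonormal_basis_finite[OF basis])
  have "S \<noteq> {}"
  proof
    assume "S = {}"
    then show False
      using orthonormal_basis_completeness[OF basis, of undefined undefined] by simp
  qed
  define \<Lambda> where "\<Lambda> = rayleigh W ` S"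
  define \<theta> where "\<theta> = Min \<Lambda>"
  have "finite \<Lambda>" "\<Lambda> \<noteq> {}"
    using fin \<open>S \<noteq> {}\<close> by (auto simp: \<Lambda>_def)
  then have "\<theta> \<in> \<Lambda>"
    unfolding \<theta>_def by (rule Min_in)
  have least: "\<theta> \<le> rayleigh W v" if "v \<in> S" for v
    using \<open>finite \<Lambda>\<close> that by (auto simp: \<theta>_def \<Lambda>_def)
  have "trace W = 0"
    using assms(1) by (simp add: assms(3) trace_def adjacency_matrix_def simple_graph_def irreflp_def)
  then have "real (card S) * \<theta> \<le> 0"
    using sum_bounded_below[of S \<theta> "rayleigh W"] least by (simp add: trace_eigenbasis[OF basis])
  then have nonpos: "\<theta> \<le> 0"
    using fin \<open>S \<noteq> {}\<close> by (simp add: mult_le_0_iff card_gt_0_iff)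
  \<comment> \<open>The function \<open>g\<close> kills every eigenvalue but \<open>\<theta>\<close>, so \<open>g(W)\<close> is a multiple of the projector;
      writing the factors as \<open>t - x\<close> makes the multiple positive, because \<open>\<theta>\<close> is least.\<close>
  define g where "g x = (\<Prod>t\<in>\<Lambda> - {\<theta>}. t - x)" for x
  have g_zero: "g x = 0" if "x \<in> \<Lambda>" "x \<noteq> \<theta>" for x
    using that \<open>finite \<Lambda>\<close> by (auto simp: g_def)
  have g_pos: "0 < g \<theta>"
    using Min_le[OF \<open>finite \<Lambda>\<close>] unfolding g_def \<theta>_def
    by (intro prod_pos) (force simp: less_le)
  obtain f where f: "\<And>u w. spectral_fun S W g u w = f (graph_dist E u w)"
    using dist_determined_spectral_prod[OF assms(1,2), of S "\<Lambda> - {\<theta>}"] assms(3,4) \<open>finite \<Lambda>\<close>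
    unfolding dist_determined_def g_def[abs_def] by auto
  have g_nonneg: "0 \<le> g (rayleigh W v)" if "v \<in> S" for v
    using that g_zero g_pos by (cases "rayleigh W v = \<theta>") (auto simp: \<Lambda>_def)
  have diag: "(\<Sum>v\<in>S. g (rayleigh W v) * (v $ i * v $ i)) = f 0" for i
    using f[of i i] assms(2)
    by (simp add: spectral_fun_def graph_dist_eq_0_iff[THEN iffD2] distance_regular_def)
  obtain v0 where v0: "v0 \<in> S" "rayleigh W v0 = \<theta>"
    using \<open>\<theta> \<in> \<Lambda>\<close> by (auto simp: \<Lambda>_def)
  \<comment> \<open>The constant diagonal entry is positive, since some coordinate of an eigenvector of \<open>\<theta>\<close> is
      nonzero.\<close>
  have "f 0 > 0"
  proof -
    have "v0 \<noteq> 0"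
      using v0(1) basis by (auto simp: orthonormal_basis_def)
    then obtain i where "v0 $ i \<noteq> 0"
      by (auto simp: vec_eq_iff)
    then have "0 < g (rayleigh W v0) * (v0 $ i * v0 $ i)"
      using v0(2) g_pos by (auto simp: zero_less_mult_iff linorder_neq_iff)
    also have "\<dots> \<le> (\<Sum>v\<in>S. g (rayleigh W v) * (v $ i * v $ i))"
      using fin v0(1) g_nonneg by (intro member_le_sum) auto
    finally show ?thesis
      by (simp add: diag)
  qed
  define \<eta> where "\<eta> v = g (rayleigh W v) / f 0" for v
  have "weighted_outer S \<eta> $ i $ i = 1" for i
  proof -
    have "weighted_outer S \<eta> $ i $ i = (\<Sum>v\<in>S. g (rayleigh W v) * (v $ i * v $ i)) / f 0"
      by (simp add: weighted_outer_entry \<eta>_def sum_divide_distrib)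
    then show ?thesis
      using \<open>f 0 > 0\<close> by (simp add: diag)
  qed
  moreover have "0 \<le> \<eta> v" if "v \<in> S" for v
    using that g_nonneg \<open>f 0 > 0\<close> by (simp add: \<eta>_def)
  moreover have "rayleigh W v = \<theta>" if "v \<in> S" "\<eta> v \<noteq> 0" for v
    using that g_zero by (auto simp: \<eta>_def \<Lambda>_def)
  ultimately show ?thesis
    using optimal_values_eq[OF assms(4) least nonpos, of \<eta>] by simp
qed

end
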